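(* Let $V$ be a finite-dimensional vector space over a field $F$ (of arbitrary characteristic), let $S\leq V$ be a subspace, and let $Q\colon S\to F$ be a quadratic form with polar form $B$ and radical $R$ of $B$, such that $Q(x)=0$ for all $x\in R\setminus\{0\}$. Let $\hat S:=\operatorname{ann}_V(R)\leq V^*$. Then there exists a unique mapping $\hat Q\colon\hat S\to F$ such that for all $a^*\in\hat S$ and $x\in S$, $$a^*\mathrel{\lozenge}x\ \text{ implies }\ \hat Q(a^* )=Q(x),$$ where $\lozenge$ is the relation of being $B$-linked. This mapping $\hat Q$ is a quadratic form.
   Context: A quadratic form $Q\colon S\to F$ on an $F$-vector space $S$ is a map with $Q(cx)=c^2Q(x)$ for all $c\in F$, $x\in S$, and such that its polar form $B\colon S\times S\to F$, $B(x,y):=Q(x+y)-Q(x)-Q(y)$, is bilinear. The radical of $B$ is $R:=\{x\in S\mid B(x,y)=0\text{ for all }y\in S\}$. $V^*$ is the dual space of $V$ (its elements are called linear forms), $\langle a^*,x\rangle_V:=a^*(x)$ for $a^*\in V^*$, $x\in V$, and for $M\subseteq V$, $\operatorname{ann}_V(M):=\{a^*\in V^*\mid\langle a^*,m\rangle_V=0\text{ for all }m\in M\}$. A linear form $a^*\in\hat S=\operatorname{ann}_V(R)$ is said to be $B$-linked to a vector $x\in S$, written $a^*\mathrel{\lozenge}x$, if and only if $\langle a^*,y\rangle_V=B(x,y)$ for all $y\in S$. So $\lozenge$ is a binary relation on $\hat S\times S$. *)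

theory Defs
  imports Complex_Main "HOL-Library.Function_Algebras" "HOL-Library.FuncSet"
begin

text \<open>
  The ambient space \<open>V\<close> is a whole type \<open>'v\<close> with scalar multiplication \<open>scale\<close>; subspaces
  are sets. The dual space is a set of functions \<open>'v \<Rightarrow> 'f\<close>; addition of functions
  is pointwise (\<^theory>\<open>HOL-Library.Function_Algebras\<close>), scalar multiplication is \<open>fun_scale\<close>.
\<close>

definition fun_scale :: "'f::field \<Rightarrow> ('v \<Rightarrow> 'f) \<Rightarrow> 'v \<Rightarrow> 'f" where
  "fun_scale c a = (\<lambda>x. c * a x)"

definition dual_space :: "('f::field \<Rightarrow> 'v::ab_group_add \<Rightarrow> 'v) \<Rightarrow> ('v \<Rightarrow> 'f) set" where
  "dual_space scale = {a. Vector_Spaces.linear scale (*) a}"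

definition annihilator :: "('f::field \<Rightarrow> 'v::ab_group_add \<Rightarrow> 'v) \<Rightarrow> 'v set \<Rightarrow> ('v \<Rightarrow> 'f) set" where
  "annihilator scale M = {a \<in> dual_space scale. \<forall>m\<in>M. a m = 0}"

definition polar :: "('v::ab_group_add \<Rightarrow> 'f::field) \<Rightarrow> 'v \<Rightarrow> 'v \<Rightarrow> 'f" where
  "polar Q x y = Q (x + y) - Q x - Q y"

definition bilinear_on ::
  "('f::field \<Rightarrow> 'v::ab_group_add \<Rightarrow> 'v) \<Rightarrow> 'v set \<Rightarrow> ('v \<Rightarrow> 'v \<Rightarrow> 'f) \<Rightarrow> bool" where
  "bilinear_on scale S B \<longleftrightarrow>
     (\<forall>x\<in>S. \<forall>y\<in>S. \<forall>z\<in>S. B (x + y) z = B x z + B y z) \<and>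
     (\<forall>c. \<forall>x\<in>S. \<forall>z\<in>S. B (scale c x) z = c * B x z) \<and>
     (\<forall>x\<in>S. \<forall>y\<in>S. \<forall>z\<in>S. B z (x + y) = B z x + B z y) \<and>
     (\<forall>c. \<forall>x\<in>S. \<forall>z\<in>S. B z (scale c x) = c * B z x)"

text \<open>Only the values of \<open>Q\<close> on the subspace \<open>S\<close> matter.\<close>

definition quadratic_form_on ::
  "('f::field \<Rightarrow> 'v::ab_group_add \<Rightarrow> 'v) \<Rightarrow> 'v set \<Rightarrow> ('v \<Rightarrow> 'f) \<Rightarrow> bool" where
  "quadratic_form_on scale S Q \<longleftrightarrow>
     vector_space scale \<and> module.subspace scale S \<and>
     (\<forall>c. \<forall>x\<in>S. Q (scale c x) = c\<^sup>2 * Q x) \<and>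
     bilinear_on scale S (polar Q)"

definition form_radical :: "'v set \<Rightarrow> ('v \<Rightarrow> 'v \<Rightarrow> 'f::zero) \<Rightarrow> 'v set" where
  "form_radical S B = {x \<in> S. \<forall>y\<in>S. B x y = 0}"

definition linked ::
  "('f::field \<Rightarrow> 'v::ab_group_add \<Rightarrow> 'v) \<Rightarrow> 'v set \<Rightarrow> ('v \<Rightarrow> 'v \<Rightarrow> 'f) \<Rightarrow> ('v \<Rightarrow> 'f) \<Rightarrow> 'v \<Rightarrow> bool" where
  "linked scale S B a x \<longleftrightarrow>
     a \<in> annihilator scale (form_radical S B) \<and> x \<in> S \<and> (\<forall>y\<in>S. a y = B x y)"

lemma vector_space_fun_scale: "vector_space (fun_scale :: 'f::field \<Rightarrow> ('v \<Rightarrow> 'f) \<Rightarrow> 'v \<Rightarrow> 'f)"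
  by unfold_locales (auto simp: fun_scale_def fun_eq_iff algebra_simps)

lemma subspace_annihilator:
  assumes "vector_space scale"
  shows "module.subspace fun_scale (annihilator scale M)"
proof -
  interpret V: vector_space scale by fact
  interpret D: vector_space "fun_scale :: 'a \<Rightarrow> ('b \<Rightarrow> 'a) \<Rightarrow> 'b \<Rightarrow> 'a"
    by (rule vector_space_fun_scale)
  have F: "vector_space ((*) :: 'a \<Rightarrow> 'a \<Rightarrow> 'a)"
    by unfold_locales (auto simp: algebra_simps)
  have lin: "Vector_Spaces.linear scale (*) a \<longleftrightarrow>
      (\<forall>x y. a (x + y) = a x + a y) \<and> (\<forall>c x. a (scale c x) = c * a x)" for a
    using assms F unfolding Vector_Spaces.linear_def module_hom_def module_hom_axioms_def
    by (auto simp: module_iff_vector_space)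
  show ?thesis
    unfolding D.subspace_def annihilator_def dual_space_def lin
    by (auto simp: fun_scale_def algebra_simps)
qed

end

theory Submission
  imports Defs
begin

text \<open>
  A linear form vanishing on the common kernel of finitely many linear forms is a combination of
  them. Applied to the forms \<open>B t\<close>, with \<open>t\<close> running through a basis of \<open>S\<close>, whose common kernel
  is the radical, this shows that every element of the annihilator of the radical is linked to some
  vector of \<open>S\<close>. Two vectors linked to the same form differ by a radical vector, on which \<open>Q\<close>
  vanishes, so they have the same \<open>Q\<close>-value. As the relation is linear, the polar form of the
  resulting map is carried over from that of \<open>Q\<close>.
\<close>

lemma polar_commute: "polar Q x y = polar Q y x"
  by (simp add: polar_def add.commute)

text \<open>Induction on \<open>T\<close> with \<open>a\<close> arbitrary. For empty
  \<open>T\<close> the form \<open>a\<close> vanishes on \<open>S\<close> and the zero vector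
  represents it. In the induction step a suitable multiple of \<open>B t\<close> is subtracted from
  \<open>a\<close>, so that the remainder vanishes on the common kernel of the forms belonging to
  the smaller set.\<close>

lemma form_represents_functional:
  assumes VS: "vector_space scale" and SS: "module.subspace scale S"
    and B: "bilinear_on scale S B"
    and fin: "finite T" and TS: "T \<subseteq> S"
    and add: "\<And>x y. x \<in> S \<Longrightarrow> y \<in> S \<Longrightarrow> a (x + y) = a x + a y"
    and scl: "\<And>c x. x \<in> S \<Longrightarrow> a (scale c x) = c * a x"
    and ker: "\<And>y. y \<in> S \<Longrightarrow> \<forall>t\<in>T. B t y = 0 \<Longrightarrow> a y = 0"
  shows "\<exists>x\<in>S. \<forall>y\<in>S. a y = B x y"
proof -
  interpret vector_space scale by fact
  have Badd1: "B (x + y) z = B x z + B y z" and Badd2: "B z (x + y) = B z x + B z y"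
    if "x \<in> S" "y \<in> S" "z \<in> S" for x y z
    using B that unfolding bilinear_on_def by blast+
  have Bscl1: "B (scale c x) z = c * B x z" and Bscl2: "B z (scale c x) = c * B z x"
    if "x \<in> S" "z \<in> S" for c x z
    using B that unfolding bilinear_on_def by blast+
  note Ssc = subspace_scale[OF SS] and Sadd = subspace_add[OF SS]
  show ?thesis
    using fin TS add scl ker
  proof (induction T arbitrary: a rule: finite_induct)
    case empty
    have "B 0 y = 0" if "y \<in> S" for y
      using Bscl1[of 0 y 0] subspace_0[OF SS] that by simp
    with empty subspace_0[OF SS] show ?case by force
  next
    case (insert t T)
    then have t: "t \<in> S" and TS: "T \<subseteq> S" by auto
    show ?case
    proof (cases "\<exists>y0\<in>S. (\<forall>s\<in>T. B s y0 = 0) \<and> B t y0 \<noteq> 0")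
      \<comment> \<open>Here \<open>B t\<close> vanishes on the common kernel of the other forms, so
        dropping \<open>t\<close> leaves that kernel unchanged and the induction hypothesis applies
        to \<open>a\<close> itself.\<close>
      case False
      with insert TS show ?thesis by (intro insert.IH) auto
    next
      case True
      then obtain y0 where y0: "y0 \<in> S" "\<And>s. s \<in> T \<Longrightarrow> B s y0 = 0" "B t y0 \<noteq> 0" by blast
      \<comment> \<open>This choice makes the form \<open>a y - c * B t y\<close> vanish at
        \<open>y = y0\<close>.\<close>
      define c where "c = a y0 / B t y0"
      have "\<exists>x\<in>S. \<forall>y\<in>S. a y - c * B t y = B x y"
      proof (rule insert.IH[OF TS])
        fix y assume y: "y \<in> S" "\<forall>s\<in>T. B s y = 0"
        \<comment> \<open>Moving \<open>y\<close> along \<open>y0\<close> by this amount reaches the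
          kernel of \<open>B t\<close>; the forms from \<open>T\<close> stay zero, because they
          vanish at \<open>y0\<close> too. Hence \<open>a\<close> vanishes at the shifted
          vector.\<close>
        define d where "d = - (B t y / B t y0)"
        have B': "B s (y + scale d y0) = B s y + d * B s y0" if "s \<in> S" for s
          using that y y0 by (simp add: Badd2 Bscl2 Ssc)
        have "B t (y + scale d y0) = 0"
          using y0(3) B'[OF t] by (simp add: d_def)
        then have "a (y + scale d y0) = 0"
          using y y0(1,2) TS B' by (intro insert.prems(4)) (auto simp: Sadd Ssc)
        then have "a y + d * a y0 = 0"
          using y y0 insert.prems(2,3) by (simp add: Ssc)
        then show "a y - c * B t y = 0" by (simp add: c_def d_def)
      qed (use insert.prems(2,3) t in \<open>auto simp: Badd2 Bscl2 algebra_simps\<close>)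
      then obtain x where x: "x \<in> S" "\<And>y. y \<in> S \<Longrightarrow> a y - c * B t y = B x y" by blast
      \<comment> \<open>The subtracted multiple of \<open>B t\<close> is itself represented by
        \<open>scale c t\<close>.\<close>
      have "a y = B (x + scale c t) y" if "y \<in> S" for y
        using x(1) x(2)[OF that] t that by (simp add: Badd1 Bscl1 Ssc diff_eq_eq)
      moreover have "x + scale c t \<in> S" using x(1) t by (intro Sadd Ssc)
      ultimately show ?thesis by blast
    qed
  qed
qed

lemma linear_form_add_scale:
  assumes "a \<in> annihilator scale M"
  shows "a (x + y) = a x + a y" and "a (scale c x) = c * a x"
proof -
  have "module_hom scale (*) a"
    using assms by (simp add: annihilator_def dual_space_def Vector_Spaces.linear_def)
  then show "a (x + y) = a x + a y" and "a (scale c x) = c * a x"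
    by (rule module_hom.add, rule module_hom.scale)
qed

text \<open>A vector of \<open>S\<close> orthogonal to a basis of \<open>S\<close> is orthogonal to
  all of \<open>S\<close>, so it lies in the radical, where \<open>a\<close> vanishes. This is the
  kernel condition of \<open>form_represents_functional\<close>; \<open>sym\<close> exchanges left
  and right orthogonality.\<close>

lemma ex_linked:
  assumes fd: "finite_dimensional_vector_space scale Basis"
    and SS: "module.subspace scale S"
    and B: "bilinear_on scale S B"
    and sym: "\<And>x y. B x y = B y x"
    and a: "a \<in> annihilator scale (form_radical S B)"
  shows "\<exists>x. linked scale S B a x"
proof -
  interpret finite_dimensional_vector_space scale Basis by fact
  obtain T where T: "T \<subseteq> S" "independent T" "S \<subseteq> span T"
    by (rule basis_exists)
  have "a y = 0" if y: "y \<in> S" "\<forall>t\<in>T. B t y = 0" for y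
  proof -
    have "subspace {z \<in> S. B y z = 0}"
    proof (rule subspaceI)
      have "B y (scale 0 y) = 0 * B y y"
        using B y unfolding bilinear_on_def by blast
      then show "0 \<in> {z \<in> S. B y z = 0}" using subspace_0[OF SS] by simp
    qed (use B y subspace_add[OF SS] subspace_scale[OF SS] in
        \<open>auto simp: bilinear_on_def\<close>)
    moreover have "T \<subseteq> {z \<in> S. B y z = 0}"
      using T(1) y(2) sym[of y] by auto
    ultimately have "span T \<subseteq> {z \<in> S. B y z = 0}"
      by (intro span_minimal)
    with T(3) y(1) have "y \<in> form_radical S B"
      by (auto simp: form_radical_def)
    with a show ?thesis by (simp add: annihilator_def)
  qed
  then have "\<exists>x\<in>S. \<forall>y\<in>S. a y = B x y"
    by (rule form_represents_functional[OF vector_space_axioms SS B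
          finiteI_independent[OF T(2)] T(1) linear_form_add_scale[OF a]])
  with a show ?thesis by (auto simp: linked_def)
qed

lemma linked_add:
  assumes "vector_space scale" "module.subspace scale S" "bilinear_on scale S B"
    and "linked scale S B a x" "linked scale S B b y"
  shows "linked scale S B (a + b) (x + y)"
proof -
  interpret vector_space scale by fact
  interpret D: vector_space "fun_scale :: 'a \<Rightarrow> ('b \<Rightarrow> 'a) \<Rightarrow> 'b \<Rightarrow> 'a"
    by (rule vector_space_fun_scale)
  have "a + b \<in> annihilator scale (form_radical S B)" "x + y \<in> S"
    using assms D.subspace_add[OF subspace_annihilator[OF assms(1)]] subspace_add
    unfolding linked_def by blast+
  moreover have "B (x + y) z = B x z + B y z" if "z \<in> S" for z
    using assms(3-5) that unfolding linked_def bilinear_on_def by blast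
  ultimately show ?thesis
    using assms(4,5) by (simp add: linked_def)
qed

lemma linked_scale:
  assumes "vector_space scale" "module.subspace scale S" "bilinear_on scale S B"
    and "linked scale S B a x"
  shows "linked scale S B (fun_scale c a) (scale c x)"
proof -
  interpret vector_space scale by fact
  interpret D: vector_space "fun_scale :: 'a \<Rightarrow> ('b \<Rightarrow> 'a) \<Rightarrow> 'b \<Rightarrow> 'a"
    by (rule vector_space_fun_scale)
  have "fun_scale c a \<in> annihilator scale (form_radical S B)" "scale c x \<in> S"
    using assms D.subspace_scale[OF subspace_annihilator[OF assms(1)]] subspace_scale
    unfolding linked_def by blast+
  moreover have "B (scale c x) z = c * B x z" if "z \<in> S" for z
    using assms(3,4) that unfolding linked_def bilinear_on_def by blast
  ultimately show ?thesis
    using assms(4) by (simp add: linked_def fun_scale_def)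
qed

text \<open>With \<open>r\<close> the difference of \<open>x\<close> and \<open>y\<close>, the value
  \<open>Q x\<close> is \<open>Q r + Q y + polar Q r y\<close>, and \<open>r\<close> lies in the
  radical. \<open>Q0\<close> covers the case \<open>x = y\<close>, since \<open>rad\<close> speaks
  of nonzero vectors only.\<close>

lemma linked_same_value:
  assumes "vector_space scale" "module.subspace scale S" "bilinear_on scale S (polar Q)"
    and Q0: "Q 0 = 0"
    and rad: "\<forall>x \<in> form_radical S (polar Q) - {0}. Q x = 0"
    and x: "linked scale S (polar Q) a x" and y: "linked scale S (polar Q) a y"
  shows "Q x = Q y"
proof -
  interpret vector_space scale by fact
  \<comment> \<open>The difference is written as a sum with a scalar multiple, so that the clauses
    of \<open>bilinear_on\<close> apply directly.\<close>
  define r where "r = x + scale (- 1) y"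
  have S: "x \<in> S" "y \<in> S" using x y by (auto simp: linked_def)
  then have rS: "r \<in> S"
    unfolding r_def by (intro subspace_add subspace_scale assms(2))
  have "polar Q r z = 0" if z: "z \<in> S" for z
  proof -
    have "scale (- 1) y \<in> S" using assms(2) S(2) by (rule subspace_scale)
    then have "polar Q r z = polar Q x z + (- 1) * polar Q y z"
      using assms(3) S z unfolding bilinear_on_def r_def by metis
    with x y z show ?thesis by (auto simp: linked_def)
  qed
  with rS have r: "r \<in> form_radical S (polar Q)" by (simp add: form_radical_def)
  with rad Q0 have "Q r = 0" by (cases "r = 0") auto
  moreover have "polar Q r y = 0" using r S by (simp add: form_radical_def)
  moreover have "r + y = x" by (simp add: r_def)
  ultimately show ?thesis by (simp add: polar_def)
qed

lemma quadratic_form_on_linked: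
  assumes VS: "vector_space scale" and SS: "module.subspace scale S"
    and qf: "quadratic_form_on scale S Q"
    and ex: "\<And>a. a \<in> annihilator scale (form_radical S (polar Q)) \<Longrightarrow>
               \<exists>x. linked scale S (polar Q) a x"
    and val: "\<And>a x. linked scale S (polar Q) a x \<Longrightarrow> Qhat a = Q x"
  shows "quadratic_form_on fun_scale (annihilator scale (form_radical S (polar Q))) Qhat"
proof -
  let ?A = "annihilator scale (form_radical S (polar Q))"
  interpret D: vector_space "fun_scale :: 'a \<Rightarrow> ('b \<Rightarrow> 'a) \<Rightarrow> 'b \<Rightarrow> 'a"
    by (rule vector_space_fun_scale)
  have B: "bilinear_on scale S (polar Q)"
    and Qscl: "\<And>c x. x \<in> S \<Longrightarrow> Q (scale c x) = c\<^sup>2 * Q x"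
    using qf by (auto simp: quadratic_form_on_def)
  note A = subspace_annihilator[OF VS, of "form_radical S (polar Q)"]
  \<comment> \<open>The polar form of \<open>Qhat\<close> is thus evaluation at a vector linked to
    the second argument. Linearity in the first argument is then immediate, the operations on forms
    being pointwise; symmetry gives the second argument.\<close>
  have eval: "polar Qhat a b = a y"
    if a: "a \<in> ?A" and y: "linked scale S (polar Q) b y" for a b y
  proof -
    obtain x where x: "linked scale S (polar Q) a x" using ex[OF a] by blast
    have "polar Qhat a b = polar Q x y"
      using val[OF linked_add[OF VS SS B x y]] val[OF x] val[OF y] by (simp add: polar_def)
    also have "\<dots> = a y" using x y by (auto simp: linked_def)
    finally show ?thesis .
  qed
  have add: "polar Qhat (a + b) c = polar Qhat a c + polar Qhat b c"
    if h: "a \<in> ?A" "b \<in> ?A" "c \<in> ?A" for a b c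
  proof -
    obtain z where z: "linked scale S (polar Q) c z" using ex[OF h(3)] by blast
    show ?thesis
      using eval[OF h(1) z] eval[OF h(2) z] eval[OF D.subspace_add[OF A h(1,2)] z]
      by simp
  qed
  have scl: "polar Qhat (fun_scale c a) b = c * polar Qhat a b"
    if h: "a \<in> ?A" "b \<in> ?A" for a b c
  proof -
    obtain z where z: "linked scale S (polar Q) b z" using ex[OF h(2)] by blast
    show ?thesis
      using eval[OF h(1) z] eval[OF D.subspace_scale[OF A h(1)] z]
      by (simp add: fun_scale_def)
  qed
  have "bilinear_on fun_scale ?A (polar Qhat)"
    unfolding bilinear_on_def
  proof (intro conjI ballI allI)
    fix a b c assume "a \<in> ?A" "b \<in> ?A" "c \<in> ?A"
    then show "polar Qhat (a + b) c = polar Qhat a c + polar Qhat b c" by (rule add)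
    then show "polar Qhat c (a + b) = polar Qhat c a + polar Qhat c b"
      by (simp only: polar_commute[of Qhat c])
  next
    fix c a b assume "a \<in> ?A" "b \<in> ?A"
    then show "polar Qhat (fun_scale c a) b = c * polar Qhat a b" by (rule scl)
    then show "polar Qhat b (fun_scale c a) = c * polar Qhat b a"
      by (simp only: polar_commute[of Qhat b])
  qed
  moreover have "Qhat (fun_scale c a) = c\<^sup>2 * Qhat a" if a: "a \<in> ?A" for a c
  proof -
    obtain x where x: "linked scale S (polar Q) a x" using ex[OF a] by blast
    then have "x \<in> S" by (simp add: linked_def)
    then show ?thesis using val[OF x] val[OF linked_scale[OF VS SS B x]] Qscl by simp
  qed
  ultimately show ?thesis
    using A D.vector_space_axioms by (simp add: quadratic_form_on_def)
qed

text \<open>Membership in \<open>extensional\<close> fixes the values outside the annihilator, so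
  that uniqueness of a map on the annihilator becomes uniqueness of a total function.\<close>

theorem theorem4p1:
  fixes scale :: "'f::field \<Rightarrow> 'v::ab_group_add \<Rightarrow> 'v"
    and Basis :: "'v set"
    and S :: "'v set"
    and Q :: "'v \<Rightarrow> 'f"
  assumes "finite_dimensional_vector_space scale Basis"
    and "module.subspace scale S"
    and "quadratic_form_on scale S Q"
    and "\<forall>x \<in> form_radical S (polar Q) - {0}. Q x = 0"
  shows "(\<exists>!Qhat. Qhat \<in> extensional (annihilator scale (form_radical S (polar Q))) \<and>
            (\<forall>a \<in> annihilator scale (form_radical S (polar Q)). \<forall>x \<in> S.
               linked scale S (polar Q) a x \<longrightarrow> Qhat a = Q x)) \<and>
         (\<forall>Qhat. Qhat \<in> extensional (annihilator scale (form_radical S (polar Q))) \<and>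
            (\<forall>a \<in> annihilator scale (form_radical S (polar Q)). \<forall>x \<in> S.
               linked scale S (polar Q) a x \<longrightarrow> Qhat a = Q x)
            \<longrightarrow> quadratic_form_on fun_scale (annihilator scale (form_radical S (polar Q))) Qhat)"
proof -
  let ?A = "annihilator scale (form_radical S (polar Q))"
  let ?P = "\<lambda>Qhat. Qhat \<in> extensional ?A \<and>
    (\<forall>a \<in> ?A. \<forall>x \<in> S. linked scale S (polar Q) a x \<longrightarrow> Qhat a = Q x)"
  interpret finite_dimensional_vector_space scale Basis by fact
  note VS = vector_space_axioms and SS = assms(2)
  have B: "bilinear_on scale S (polar Q)"
    using assms(3) by (simp add: quadratic_form_on_def)
  have "Q (scale 0 0) = 0\<^sup>2 * Q 0"
    using assms(3) subspace_0[OF SS] unfolding quadratic_form_on_def by blast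
  then have Q0: "Q 0 = 0" by simp
  have ex: "\<exists>x. linked scale S (polar Q) a x" if "a \<in> ?A" for a
    using ex_linked[OF assms(1) SS B polar_commute that] .
  have same: "Q x = Q y"
    if "linked scale S (polar Q) a x" "linked scale S (polar Q) a y" for a x y
    using linked_same_value[OF VS SS B Q0 assms(4) that] .
  have linkedD: "a \<in> ?A" "x \<in> S" if "linked scale S (polar Q) a x" for a x
    using that by (auto simp: linked_def)
  have "\<exists>!Qhat. ?P Qhat"
  proof (rule ex_ex1I)
    \<comment> \<open>By \<open>same\<close>, the value does not depend on which linked vector is
      chosen.\<close>
    define q where "q = restrict (\<lambda>a. Q (SOME x. linked scale S (polar Q) a x)) ?A"
    have "q a = Q x" if "linked scale S (polar Q) a x" for a x
      using same[OF someI[of "linked scale S (polar Q) a", OF that] that] linkedD[OF that]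
      by (simp add: q_def)
    moreover have "q \<in> extensional ?A" by (simp add: q_def)
    ultimately have "?P q" by blast
    then show "\<exists>Qhat. ?P Qhat" by blast
  next
    fix q q' assume P: "?P q" "?P q'"
    show "q = q'"
    proof (rule extensionalityI[of _ ?A])
      fix a assume a: "a \<in> ?A"
      \<comment> \<open>Since every \<open>a\<close> in the annihilator is linked to some
        \<open>x\<close>, both maps are forced to take the value \<open>Q x\<close> at
        \<open>a\<close>.\<close>
      with ex obtain x where "linked scale S (polar Q) a x" by blast
      with P a linkedD show "q a = q' a" by metis
    qed (use P in auto)
  qed
  moreover have "quadratic_form_on fun_scale ?A q" if "?P q" for q
    using that linkedD by (intro quadratic_form_on_linked[OF VS SS assms(3) ex]) blast+
  ultimately show ?thesis by blast
qed

end
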